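(* Let $\mathbb{k}$ be an algebraically closed field and let $p,q\in\mathbb{k}^*$ with $pq\neq1$ be primitive $m$-th and $n$-th roots of unity, respectively. For every $\lambda\in\mathbb{k}^*$, the right $\mathcal{H}_{p,q}$-module $\mathcal{V}_3(\lambda)$ is a simple module of dimension $\operatorname{ord}(pq)$.
   Context: For $p,q\in\mathbb{k}^*=\mathbb{k}\setminus\{0\}$, $\mathcal{H}_{p,q}$ is the $\mathbb{k}$-algebra generated by $x,y,z$ subject to the relations $zx=p^{-1}xz$, $zy=pyz$, $yx-qxy=z$. All modules are right modules. $\operatorname{ord}(pq)$ is the multiplicative order of $pq$ in $\mathbb{k}^*$. Put $[k]_{p,q}:=\frac{q^k-p^{-k}}{q-p^{-1}}=\sum_{i=0}^{k-1}q^ip^{-(k-1-i)}$. $\mathcal{V}_3(\lambda)$ is the $\mathbb{k}$-vector space with basis $\{v_k\mid 0\le k\le \operatorname{ord}(pq)-1\}$ and right $\mathcal{H}_{p,q}$-module structure given by $$v_kz=p^{-k}\lambda v_k,\qquad v_ky=\begin{cases}v_{k+1},&0\le k\le \operatorname{ord}(pq)-2\\ 0,&k=\operatorname{ord}(pq)-1,\end{cases}\qquad v_kx=\begin{cases}\lambda[k]_{p,q}v_{k-1},&1\le k\le \operatorname{ord}(pq)-1\\ 0,&k=0.\end{cases}$$ *)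

theory Defs
  imports
    "HOL-Algebra.Algebra"
    "HOL-Algebra.Algebraic_Closure_Type"
    "HOL-Library.Poly_Mapping"
begin

subsection \<open>Roots of unity and multiplicative order\<close>

definition primitive_root_of_unity :: "nat \<Rightarrow> 'k::field \<Rightarrow> bool" where
  "primitive_root_of_unity n u \<longleftrightarrow> 0 < n \<and> u ^ n = 1 \<and> (\<forall>j. 0 < j \<and> j < n \<longrightarrow> u ^ j \<noteq> 1)"

text \<open>The order in the group \<open>k\<^sup>*\<close>; it is \<open>0\<close> for elements of infinite order.\<close>

definition mult_ord :: "'k::field \<Rightarrow> nat" where
  "mult_ord u = group.ord (Multiplicative_Group.mult_of (ring_of_type_algebra :: 'k ring)) u"


subsection \<open>Free objects\<close>

datatype 'a free_monoid = Mon (letters: "'a list")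

instantiation free_monoid :: (type) monoid_add
begin
definition "0 = Mon []"
definition "u + w = Mon (letters u @ letters w)"
instance by standard (simp_all add: zero_free_monoid_def plus_free_monoid_def)
end

text \<open>
  \<open>'b \<Rightarrow>\<^sub>0 'k\<close> is the vector space with basis \<open>'b\<close>.  For a monoid \<open>'b\<close> (written additively) it
  is the monoid algebra, so \<open>'a free_monoid \<Rightarrow>\<^sub>0 'k\<close> is the free unital associative algebra
  on \<open>'a\<close>.
\<close>

type_synonym ('a, 'k) free_algebra = "'a free_monoid \<Rightarrow>\<^sub>0 'k"

definition scale :: "'k::field \<Rightarrow> ('b \<Rightarrow>\<^sub>0 'k) \<Rightarrow> ('b \<Rightarrow>\<^sub>0 'k)" where
  "scale c v = Poly_Mapping.map (\<lambda>x. c * x) v"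

definition basis_vec :: "'b \<Rightarrow> ('b \<Rightarrow>\<^sub>0 'k::field)" where
  "basis_vec b = Poly_Mapping.single b 1"

definition linear_extension :: "('b \<Rightarrow> ('c \<Rightarrow>\<^sub>0 'k)) \<Rightarrow> ('b \<Rightarrow>\<^sub>0 'k::field) \<Rightarrow> ('c \<Rightarrow>\<^sub>0 'k)" where
  "linear_extension g f =
     (\<Sum>b\<in>Poly_Mapping.keys f. scale (Poly_Mapping.lookup f b) (g b))"


subsection \<open>The algebra \<open>H\<^sub>p\<^sub>q\<close>\<close>

datatype gen = Gen_x | Gen_y | Gen_z

definition gen :: "gen \<Rightarrow> (gen, 'k::field) free_algebra" where
  "gen a = basis_vec (Mon [a])"

definition H_relations :: "'k::field \<Rightarrow> 'k \<Rightarrow> (gen, 'k) free_algebra set" where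
  "H_relations p q =
     {gen Gen_z * gen Gen_x - scale (inverse p) (gen Gen_x * gen Gen_z),
      gen Gen_z * gen Gen_y - scale p (gen Gen_y * gen Gen_z),
      gen Gen_y * gen Gen_x - scale q (gen Gen_x * gen Gen_y) - gen Gen_z}"

abbreviation free_ring :: "(gen, 'k::field) free_algebra ring" where
  "free_ring \<equiv> ring_of_type_algebra"

definition H_ideal :: "'k::field \<Rightarrow> 'k \<Rightarrow> (gen, 'k) free_algebra set" where
  "H_ideal p q = Idl\<^bsub>free_ring\<^esub> (H_relations p q)"

definition Hpq :: "'k::field \<Rightarrow> 'k \<Rightarrow> (gen, 'k) free_algebra set ring" where
  "Hpq p q = free_ring Quot (H_ideal p q)"

definition H_class :: "'k::field \<Rightarrow> 'k \<Rightarrow> (gen, 'k) free_algebra \<Rightarrow> (gen, 'k) free_algebra set" where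
  "H_class p q f = H_ideal p q +>\<^bsub>free_ring\<^esub> f"


subsection \<open>Right modules\<close>

text \<open>The fields \<open>mult\<close> and \<open>one\<close> inherited from \<open>ring\<close> play no role, as in the library's \<open>module\<close>.\<close>

record ('a, 'b) right_module = "'b ring" +
  raction :: "'b \<Rightarrow> 'a \<Rightarrow> 'b" (infixl \<open>\<triangleleft>\<index>\<close> 70)

locale right_module = R?: ring R + M?: abelian_group M
  for R :: "('a, 'c) ring_scheme" (structure) and M :: "('a, 'b, 'd) right_module_scheme" (structure) +
  assumes raction_closed:
      "\<lbrakk>v \<in> carrier M; a \<in> carrier R\<rbrakk> \<Longrightarrow> v \<triangleleft>\<^bsub>M\<^esub> a \<in> carrier M"
    and raction_l_distr:
      "\<lbrakk>v \<in> carrier M; w \<in> carrier M; a \<in> carrier R\<rbrakk>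
       \<Longrightarrow> (v \<oplus>\<^bsub>M\<^esub> w) \<triangleleft>\<^bsub>M\<^esub> a = (v \<triangleleft>\<^bsub>M\<^esub> a) \<oplus>\<^bsub>M\<^esub> (w \<triangleleft>\<^bsub>M\<^esub> a)"
    and raction_r_distr:
      "\<lbrakk>v \<in> carrier M; a \<in> carrier R; b \<in> carrier R\<rbrakk>
       \<Longrightarrow> v \<triangleleft>\<^bsub>M\<^esub> (a \<oplus>\<^bsub>R\<^esub> b) = (v \<triangleleft>\<^bsub>M\<^esub> a) \<oplus>\<^bsub>M\<^esub> (v \<triangleleft>\<^bsub>M\<^esub> b)"
    and raction_assoc:
      "\<lbrakk>v \<in> carrier M; a \<in> carrier R; b \<in> carrier R\<rbrakk>
       \<Longrightarrow> v \<triangleleft>\<^bsub>M\<^esub> (a \<otimes>\<^bsub>R\<^esub> b) = (v \<triangleleft>\<^bsub>M\<^esub> a) \<triangleleft>\<^bsub>M\<^esub> b"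
    and raction_one:
      "v \<in> carrier M \<Longrightarrow> v \<triangleleft>\<^bsub>M\<^esub> \<one>\<^bsub>R\<^esub> = v"

definition right_submodule ::
    "'b set \<Rightarrow> ('a, 'c) ring_scheme \<Rightarrow> ('a, 'b, 'd) right_module_scheme \<Rightarrow> bool" where
  "right_submodule N R M \<longleftrightarrow>
     subgroup N (add_monoid M) \<and> (\<forall>v\<in>N. \<forall>a\<in>carrier R. v \<triangleleft>\<^bsub>M\<^esub> a \<in> N)"

definition simple_right_module ::
    "('a, 'c) ring_scheme \<Rightarrow> ('a, 'b, 'd) right_module_scheme \<Rightarrow> bool" where
  "simple_right_module R M \<longleftrightarrow>
     right_module R M \<and> carrier M \<noteq> {\<zero>\<^bsub>M\<^esub>} \<and>
     (\<forall>N. right_submodule N R M \<longrightarrow> N = {\<zero>\<^bsub>M\<^esub>} \<or> N = carrier M)"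


subsection \<open>The module \<open>V\<^sub>3\<close>\<close>

definition pq_bracket :: "'k::field \<Rightarrow> 'k \<Rightarrow> nat \<Rightarrow> 'k" where
  "pq_bracket p q k = (q ^ k - inverse p ^ k) / (q - inverse p)"

text \<open>\<open>V3_gen p q \<lambda> a k\<close> is \<open>v\<^sub>k a\<close>; it is used for \<open>k < mult_ord (p * q)\<close> only.\<close>

definition V3_gen :: "'k::field \<Rightarrow> 'k \<Rightarrow> 'k \<Rightarrow> gen \<Rightarrow> nat \<Rightarrow> (nat \<Rightarrow>\<^sub>0 'k)" where
  "V3_gen p q l a k =
     (case a of
        Gen_z \<Rightarrow> scale (inverse p ^ k * l) (basis_vec k)
      | Gen_y \<Rightarrow> if k + 1 < mult_ord (p * q) then basis_vec (k + 1) else 0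
      | Gen_x \<Rightarrow> if 1 \<le> k then scale (l * pq_bracket p q k) (basis_vec (k - 1)) else 0)"

text \<open>A right action: the leftmost letter of a word acts first.\<close>

definition V3_word :: "'k::field \<Rightarrow> 'k \<Rightarrow> 'k \<Rightarrow> (nat \<Rightarrow>\<^sub>0 'k) \<Rightarrow> gen free_monoid \<Rightarrow> (nat \<Rightarrow>\<^sub>0 'k)" where
  "V3_word p q l v w = fold (\<lambda>a. linear_extension (V3_gen p q l a)) (letters w) v"

definition V3_free :: "'k::field \<Rightarrow> 'k \<Rightarrow> 'k \<Rightarrow> (nat \<Rightarrow>\<^sub>0 'k) \<Rightarrow> (gen, 'k) free_algebra \<Rightarrow> (nat \<Rightarrow>\<^sub>0 'k)" where
  "V3_free p q l v f = linear_extension (V3_word p q l v) f"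

text \<open>
  The elements of \<^term>\<open>Hpq p q\<close> are cosets.  All members of a coset act alike, see
  \<open>V3_raction_class\<close> below.
\<close>

definition V3 ::
    "'k::field \<Rightarrow> 'k \<Rightarrow> 'k \<Rightarrow> ((gen, 'k) free_algebra set, nat \<Rightarrow>\<^sub>0 'k) right_module" where
  "V3 p q l =
     \<lparr>carrier = {v. Poly_Mapping.keys v \<subseteq> {..<mult_ord (p * q)}},
      monoid.mult = undefined, one = undefined,
      ring.zero = 0, add = (+),
      raction = (\<lambda>v A. the_elem (V3_free p q l v ` A))\<rparr>"



subsection \<open>Well-definedness of the action on \<open>V\<^sub>3\<close>\<close>

lemma lookup_scale [simp]: "Poly_Mapping.lookup (scale c v) b = c * Poly_Mapping.lookup v b"
  unfolding scale_def by (simp add: Poly_Mapping.map.rep_eq when_def)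

lemma scale_0 [simp]: "scale c 0 = 0" "scale 0 v = 0"
  by (rule poly_mapping_eqI, simp)+

lemma scale_add: "scale c (v + w) = scale c v + scale c w" "scale (c + d) v = scale c v + scale d v"
  by (rule poly_mapping_eqI, simp add: lookup_add algebra_simps)+

lemma scale_scale [simp]: "scale c (scale d v) = scale (c * d) v"
  by (rule poly_mapping_eqI) (simp add: mult.assoc)

lemma scale_one [simp]: "scale 1 v = v"
  by (rule poly_mapping_eqI) simp

lemma scale_sum: "scale c (sum g S) = (\<Sum>s\<in>S. scale c (g s))"
  by (induction S rule: infinite_finite_induct) (simp_all add: scale_add)

lemma vector_space_scale: "vector_space (scale :: 'k::field \<Rightarrow> ('b \<Rightarrow>\<^sub>0 'k) \<Rightarrow> _)"
  by unfold_locales (simp_all add: scale_add)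

lemma single_eq_scale: "Poly_Mapping.single b c = scale c (basis_vec b)"
  by (rule poly_mapping_eqI) (simp add: basis_vec_def lookup_single when_def)

lemma linear_extension_superset:
  assumes "finite S" "Poly_Mapping.keys f \<subseteq> S"
  shows "linear_extension g f = (\<Sum>b\<in>S. scale (Poly_Mapping.lookup f b) (g b))"
  unfolding linear_extension_def
  by (rule sum.mono_neutral_left) (use assms in \<open>auto simp: in_keys_iff\<close>)

lemma linear_extension_0 [simp]: "linear_extension g 0 = 0"
  by (simp add: linear_extension_def)

lemma linear_extension_add: "linear_extension g (f + h) = linear_extension g f + linear_extension g h"
proof -
  let ?S = "Poly_Mapping.keys f \<union> Poly_Mapping.keys h"
  have "Poly_Mapping.keys (f + h) \<subseteq> ?S" by (rule Poly_Mapping.keys_add)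
  then show ?thesis
    by (simp add: linear_extension_superset[of ?S] lookup_add scale_add sum.distrib)
qed

lemma linear_extension_scale: "linear_extension g (scale c f) = scale c (linear_extension g f)"
proof -
  have "Poly_Mapping.keys (scale c f) \<subseteq> Poly_Mapping.keys f"
    by (auto simp: in_keys_iff)
  then show ?thesis
    by (simp add: linear_extension_superset[of "Poly_Mapping.keys f"] scale_sum)
qed

lemma linear_extension_basis [simp]: "linear_extension g (basis_vec b) = g b"
  by (subst linear_extension_superset[of "{b}"]) (auto simp: basis_vec_def)

lemma linear_extension_uminus: "linear_extension g (- f) = - linear_extension g f"
  using linear_extension_add[of g "-f" f] by (simp add: eq_neg_iff_add_eq_0)

lemma linear_extension_diff: "linear_extension g (f - h) = linear_extension g f - linear_extension g h"
  using linear_extension_add[of g f "- h"] by (simp add: linear_extension_uminus)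

lemma V3_word_linear:
  "V3_word p q l (u + v) w = V3_word p q l u w + V3_word p q l v w"
  "V3_word p q l (scale c v) w = scale c (V3_word p q l v w)"
proof -
  have "fold (\<lambda>a. linear_extension (V3_gen p q l a)) as (u + v) =
        fold (\<lambda>a. linear_extension (V3_gen p q l a)) as u + fold (\<lambda>a. linear_extension (V3_gen p q l a)) as v"
    for as u v by (induction as arbitrary: u v) (simp_all add: linear_extension_add)
  then show "V3_word p q l (u + v) w = V3_word p q l u w + V3_word p q l v w"
    by (simp add: V3_word_def)
  have "fold (\<lambda>a. linear_extension (V3_gen p q l a)) as (scale c v) =
        scale c (fold (\<lambda>a. linear_extension (V3_gen p q l a)) as v)"
    for as v by (induction as arbitrary: v) (simp_all add: linear_extension_scale)
  then show "V3_word p q l (scale c v) w = scale c (V3_word p q l v w)"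
    by (simp add: V3_word_def)
qed

lemma V3_word_plus: "V3_word p q l v (u + w) = V3_word p q l (V3_word p q l v u) w"
  by (simp add: V3_word_def plus_free_monoid_def)

lemma V3_free_linear:
  "V3_free p q l (u + v) f = V3_free p q l u f + V3_free p q l v f"
  "V3_free p q l (scale c v) f = scale c (V3_free p q l v f)"
  by (simp_all add: V3_free_def linear_extension_def V3_word_linear scale_add scale_sum
      sum.distrib mult.commute)

lemma V3_free_add: "V3_free p q l v (f + g) = V3_free p q l v f + V3_free p q l v g"
  and V3_free_diff: "V3_free p q l v (f - g) = V3_free p q l v f - V3_free p q l v g"
  and V3_free_scale: "V3_free p q l v (scale c f) = scale c (V3_free p q l v f)"
  and V3_free_zero [simp]: "V3_free p q l v 0 = 0"
  by (simp_all add: V3_free_def linear_extension_add linear_extension_diff linear_extension_scale)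

lemma V3_free_zero_left [simp]: "V3_free p q l 0 f = 0"
  using V3_free_linear(2)[of p q l 0 0 f] by simp

lemma V3_free_one: "V3_free p q l v 1 = v"
proof -
  have *: "1 = (basis_vec 0 :: (gen, 'a) free_algebra)" by (simp add: basis_vec_def)
  show ?thesis unfolding V3_free_def * linear_extension_basis
    by (simp add: V3_word_def zero_free_monoid_def)
qed

lemma V3_free_gen: "V3_free p q l v (gen a) = linear_extension (V3_gen p q l a) v"
  by (simp add: V3_free_def gen_def V3_word_def)

lemma poly_mapping_basis_induct [case_names zero add]:
  fixes f :: "'b \<Rightarrow>\<^sub>0 'k::field"
  assumes "P 0" and "\<And>c b f. P f \<Longrightarrow> P (scale c (basis_vec b) + f)"
  shows "P f"
proof (induction f rule: Poly_Mapping.update_induct)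
  case const
  then show ?case using assms(1) by simp
next
  case (update f a b)
  have "Poly_Mapping.update a b f = scale b (basis_vec a) + f"
    using update(1)
    by (intro poly_mapping_eqI)
      (auto simp: lookup_update lookup_add basis_vec_def lookup_single when_def in_keys_iff)
  then show ?case using assms(2) update by simp
qed

lemma V3_free_mult: "V3_free p q l v (f * g) = V3_free p q l (V3_free p q l v f) g"
proof (induction f arbitrary: v rule: poly_mapping_basis_induct)
  case zero
  then show ?case by simp
next
  case (add c u f)
  have "V3_free p q l v (scale c (basis_vec u) * g) =
        V3_free p q l (V3_free p q l v (scale c (basis_vec u))) g"
  proof (induction g rule: poly_mapping_basis_induct)
    case zero
    then show ?case by simp
  next
    case (add d w g)
    have "scale c (basis_vec u) * scale d (basis_vec w) = scale (c * d) (basis_vec (u + w))"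
      by (simp add: single_eq_scale[symmetric] mult_single)
    then show ?case using add
      by (simp add: distrib_left V3_free_add V3_free_scale)
        (simp add: V3_free_def V3_word_plus V3_word_linear mult.commute)
  qed
  then show ?case using add by (simp add: distrib_right V3_free_add V3_free_linear)
qed

lemma ring_free_ring: "ring (free_ring :: (gen, 'k::field) free_algebra ring)"
proof -
  have "\<exists>y. x + y = 0" for x :: "(gen, 'k) free_algebra"
    using add.right_inverse by blast
  then show ?thesis
    unfolding ring_of_type_algebra_def using add.right_inverse
    by unfold_locales (auto simp: algebra_simps Units_def)
qed

lemma field_power_of_type:
  "x [^]\<^bsub>Multiplicative_Group.mult_of (ring_of_type_algebra :: 'k::field ring)\<^esub> (n::nat) = x ^ n"
  by (induction n) (simp_all add: Multiplicative_Group.nat_pow_mult_of ring_of_type_algebra_def nat_pow_def mult.commute)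

lemma power_eq_1_iff_mult_ord:
  assumes "u \<noteq> (0::'k::field)"
  shows "u ^ n = 1 \<longleftrightarrow> mult_ord u dvd n"
proof -
  interpret F: field "ring_of_type_algebra :: 'k ring" by (rule field_from_type_algebra)
  interpret G: group "Multiplicative_Group.mult_of (ring_of_type_algebra :: 'k ring)" by (rule F.field_mult_group)
  have "u \<in> carrier (Multiplicative_Group.mult_of (ring_of_type_algebra :: 'k ring))"
    using assms by (simp add: ring_of_type_algebra_def)
  from G.pow_eq_id[OF this, of n] show ?thesis
    by (simp add: field_power_of_type mult_ord_def) (simp add: ring_of_type_algebra_def)
qed


lemma pq_bracket_eq_sum:
  assumes "p \<noteq> 0" "p * q \<noteq> 1"
  shows "pq_bracket p q k = (\<Sum>i<k. q ^ i * inverse p ^ (k - 1 - i))"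
proof (cases k)
  case (Suc m)
  have "q \<noteq> inverse p" using assms by auto
  moreover have "q ^ k - inverse p ^ k = (q - inverse p) * (\<Sum>i<k. q ^ i * inverse p ^ (k - 1 - i))"
    unfolding Suc power_diff_sumr2 by (simp add: mult.commute)
  ultimately show ?thesis by (simp add: pq_bracket_def)
qed (simp add: pq_bracket_def)

lemma pq_bracket_Suc:
  assumes "p \<noteq> 0" "p * q \<noteq> 1"
  shows "pq_bracket p q (k + 1) = q * pq_bracket p q k + inverse p ^ k"
proof -
  have "(q ^ (k + 1) - r ^ (k + 1)) / (q - r) = q * ((q ^ k - r ^ k) / (q - r)) + r ^ k"
    if "q - r \<noteq> 0" for r
    using that by (simp add: divide_simps) (simp add: algebra_simps)
  moreover have "q - inverse p \<noteq> 0" using assms by auto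
  ultimately show ?thesis by (simp add: pq_bracket_def)
qed

lemma pq_bracket_mult_ord:
  assumes "p \<noteq> 0" "q \<noteq> 0"
  shows "pq_bracket p q (mult_ord (p * q)) = 0"
proof -
  have "(p * q) ^ mult_ord (p * q) = 1"
    using assms by (simp add: power_eq_1_iff_mult_ord)
  then have "q ^ mult_ord (p * q) = inverse p ^ mult_ord (p * q)"
    using assms by (simp add: power_mult_distrib field_simps)
  then show ?thesis by (simp add: pq_bracket_def)
qed

lemma additive_eq_linear_extension:
  assumes "\<And>u v. T (u + v) = T u + T v" and "\<And>c v. T (scale c v) = scale c (T v)"
  shows "T v = linear_extension (\<lambda>b. T (basis_vec b)) v"
proof (induction v rule: poly_mapping_basis_induct)
  case zero
  then show ?case using assms(2)[of 0 0] by simp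
qed (simp add: assms linear_extension_add linear_extension_scale)

lemma V3_free_relations:
  assumes "p \<noteq> 0" "q \<noteq> 0" "p * q \<noteq> 1"
    and "r \<in> H_relations p q" and "Poly_Mapping.keys v \<subseteq> {..<mult_ord (p * q)}"
  shows "V3_free p q l v r = 0"
proof -
  have "V3_free p q l (basis_vec k) r = 0" if k: "k < mult_ord (p * q)" for k
  proof -
    have Z_X: "V3_free p q l (basis_vec k) (gen Gen_z * gen Gen_x - scale (inverse p) (gen Gen_x * gen Gen_z)) = 0"
      by (cases k)
        (simp_all add: V3_free_mult V3_free_diff V3_free_scale V3_free_gen V3_gen_def
          linear_extension_scale mult.commute mult.left_commute)
    have Z_Y: "V3_free p q l (basis_vec k) (gen Gen_z * gen Gen_y - scale p (gen Gen_y * gen Gen_z)) = 0"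
      using assms(1)
      by (simp add: V3_free_mult V3_free_diff V3_free_scale V3_free_gen V3_gen_def
          linear_extension_scale mult.assoc[symmetric])
    have br: "pq_bracket p q (Suc k) = q * pq_bracket p q k + inverse p ^ k"
      using pq_bracket_Suc[OF assms(1,3), of k] by simp
    have br0: "q * pq_bracket p q k + inverse p ^ k = 0" if "\<not> Suc k < mult_ord (p * q)"
    proof -
      have "Suc k = mult_ord (p * q)" using that k by simp
      then show ?thesis using br pq_bracket_mult_ord[OF assms(1,2)] by simp
    qed
    have "V3_free p q l (basis_vec k) (gen Gen_y * gen Gen_x - scale q (gen Gen_x * gen Gen_y) - gen Gen_z) =
        scale (l * (if Suc k < mult_ord (p * q) then pq_bracket p q (Suc k) else 0)
          - l * (q * pq_bracket p q k + inverse p ^ k)) (basis_vec k)"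
    proof (cases "k = 0")
      case True
      then show ?thesis
        by (intro poly_mapping_eqI)
          (simp add: V3_free_mult V3_free_diff V3_free_scale V3_free_gen V3_gen_def
            linear_extension_scale lookup_minus pq_bracket_def left_diff_distrib)
    next
      case False
      then show ?thesis
        unfolding V3_free_mult V3_free_diff V3_free_scale V3_free_gen V3_gen_def
        using k by (intro poly_mapping_eqI)
          (simp add: linear_extension_scale lookup_minus lookup_add V3_gen_def algebra_simps)
    qed
    also have "\<dots> = 0" using br br0 by simp
    finally show ?thesis using assms(4) Z_X Z_Y by (auto simp: H_relations_def)
  qed
  then show ?thesis
    using assms(5)
    by (subst additive_eq_linear_extension[of "\<lambda>v. V3_free p q l v r"])
      (auto simp: V3_free_linear linear_extension_def intro!: sum.neutral)
qed

lemma V3_free_closed: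
  assumes "Poly_Mapping.keys v \<subseteq> {..<mult_ord (p * q)}"
  shows "Poly_Mapping.keys (V3_free p q l v f) \<subseteq> {..<mult_ord (p * q)}"
proof -
  let ?V = "{v :: nat \<Rightarrow>\<^sub>0 'a. \<forall>k\<ge>mult_ord (p * q). Poly_Mapping.lookup v k = 0}"
  have V: "Poly_Mapping.keys v \<subseteq> {..<mult_ord (p * q)} \<longleftrightarrow> v \<in> ?V" for v :: "nat \<Rightarrow>\<^sub>0 'a"
    by (force simp: in_keys_iff not_less[symmetric])
  have sum: "(\<And>b. b \<in> S \<Longrightarrow> h b \<in> ?V) \<Longrightarrow> (\<Sum>b\<in>S. h b) \<in> ?V" for h :: "'b \<Rightarrow> _" and S
    by (simp add: lookup_sum)
  have le: "linear_extension h u \<in> ?V" if "\<And>b. b \<in> Poly_Mapping.keys u \<Longrightarrow> h b \<in> ?V"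
    for h :: "'b \<Rightarrow> _" and u
    using that by (simp add: linear_extension_def lookup_sum)
  have g: "V3_gen p q l a k \<in> ?V" if "k < mult_ord (p * q)" for a k
    using that by (auto simp: V3_gen_def basis_vec_def lookup_single when_def split: gen.split)
  have "fold (\<lambda>a. linear_extension (V3_gen p q l a)) as u \<in> ?V" if "u \<in> ?V" for as u
    using that
  proof (induction as arbitrary: u)
    case (Cons a as)
    have "linear_extension (V3_gen p q l a) u \<in> ?V"
    proof (rule le)
      fix b assume "b \<in> Poly_Mapping.keys u"
      then have "b < mult_ord (p * q)" using Cons.prems V[of u] by auto
      then show "V3_gen p q l a b \<in> ?V" by (rule g)
    qed
    then show ?case using Cons.IH by simp
  qed simp
  then have "V3_word p q l v w \<in> ?V" for w
    using assms unfolding V V3_word_def by blast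
  then show ?thesis unfolding V V3_free_def by (intro le)
qed

lemma V3_free_ideal:
  assumes "p \<noteq> 0" "q \<noteq> 0" "p * q \<noteq> 1"
    and "f \<in> H_ideal p q" and "Poly_Mapping.keys v \<subseteq> {..<mult_ord (p * q)}"
  shows "V3_free p q l v f = 0"
proof -
  interpret F: ring "free_ring :: (gen, 'a) free_algebra ring" by (rule ring_free_ring)
  let ?I = "{f. \<forall>v. Poly_Mapping.keys v \<subseteq> {..<mult_ord (p * q)} \<longrightarrow> V3_free p q l v f = 0}"
  have "ideal ?I free_ring"
  proof (rule idealI)
    show "subgroup ?I (add_monoid (free_ring :: (gen, 'a) free_algebra ring))"
    proof (rule F.add.subgroupI)
      show "\<ominus>\<^bsub>free_ring\<^esub> f \<in> ?I" if "f \<in> ?I" for f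
      proof -
        have "(\<ominus>\<^bsub>free_ring\<^esub> f) = - f"
          by (rule F.minus_equality) (simp_all add: ring_of_type_algebra_def)
        then show ?thesis using that V3_free_diff[of p q l _ 0 f] by simp
      qed
    qed (auto simp: ring_of_type_algebra_def V3_free_add intro!: exI[of _ 0])
  qed (auto simp: ring_of_type_algebra_def V3_free_mult V3_free_closed intro: ring_free_ring[unfolded ring_of_type_algebra_def])
  moreover have "H_relations p q \<subseteq> ?I" using V3_free_relations[OF assms(1-3)] by blast
  ultimately have "H_ideal p q \<subseteq> ?I"
    unfolding H_ideal_def by (rule F.genideal_minimal)
  then show ?thesis using assms(4,5) by blast
qed

theorem V3_raction_class:
  assumes "p \<noteq> 0" "q \<noteq> 0" "p * q \<noteq> 1" and "v \<in> carrier (V3 p q l)"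
  shows "v \<triangleleft>\<^bsub>V3 p q l\<^esub> H_class p q f = V3_free p q l v f"
proof -
  interpret F: ring "free_ring :: (gen, 'a) free_algebra ring" by (rule ring_free_ring)
  have "H_relations p q \<subseteq> carrier free_ring" by (simp add: ring_of_type_algebra_def)
  then interpret I: ideal "H_ideal p q" free_ring
    unfolding H_ideal_def by (rule F.genideal_ideal)
  have "\<zero>\<^bsub>free_ring\<^esub> \<in> H_ideal p q" by (rule I.zero_closed)
  then have 0: "0 \<in> H_ideal p q" by (simp add: ring_of_type_algebra_def)
  have cl: "H_class p q f = (\<lambda>h. h + f) ` H_ideal p q"
    by (auto simp: H_class_def a_r_coset_def' ring_of_type_algebra_def)
  have "V3_free p q l v ` H_class p q f = {V3_free p q l v f}"
  proof -
    have "V3_free p q l v (h + f) = V3_free p q l v f" if "h \<in> H_ideal p q" for h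
      using V3_free_ideal[OF assms(1-3) that] assms(4) by (simp add: V3_free_add V3_def)
    then show ?thesis using 0 by (auto simp: cl image_image)
  qed
  then show ?thesis by (simp add: V3_def)
qed

corollary V3_raction_gen:
  assumes "p \<noteq> 0" "q \<noteq> 0" "p * q \<noteq> 1" and "k < mult_ord (p * q)"
  shows "basis_vec k \<triangleleft>\<^bsub>V3 p q l\<^esub> H_class p q (gen a) = V3_gen p q l a k"
  using assms
  by (subst V3_raction_class) (simp_all add: V3_free_gen V3_def basis_vec_def[of k], simp flip: basis_vec_def)

corollary V3_raction_scalar:
  assumes "p \<noteq> 0" "q \<noteq> 0" "p * q \<noteq> 1" and "v \<in> carrier (V3 p q l)"
  shows "v \<triangleleft>\<^bsub>V3 p q l\<^esub> H_class p q (scale c 1) = scale c v"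
  using assms by (simp add: V3_raction_class V3_free_scale V3_free_one)

end

theory Submission
  imports Defs
begin

text \<open>
  Since \<open>[k]\<^sub>p\<^sub>,\<^sub>q\<close> vanishes only if \<open>ord(pq)\<close> divides \<open>k\<close>, the generator \<open>x\<close> lowers the index of
  the leading basis vector of a nonzero element by exactly one until it reaches \<open>v\<^sub>0\<close>.  Hence every
  nonzero submodule contains \<open>v\<^sub>0\<close>, and \<open>v\<^sub>0\<close> generates \<open>V\<^sub>3\<close> under \<open>y\<close>.
\<close>

lemma lookup_basis_vec [simp]: "Poly_Mapping.lookup (basis_vec b) c = (if b = c then 1 else 0)"
  unfolding basis_vec_def by (simp only: lookup_single when_def)

text \<open>An element of infinite order has \<open>mult_ord\<close> equal to \<open>0\<close>, and
  \<open>0\<close> divides no positive \<open>n\<close>; so one positive exponent giving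
  \<open>1\<close> excludes this case.\<close>

lemma mult_ord_pos:
  assumes "u \<noteq> 0" and "0 < n" and "u ^ n = 1"
  shows "0 < mult_ord u"
proof (rule Nat.gr0I)
  assume "mult_ord u = 0"
  with assms show False using power_eq_1_iff_mult_ord[of u n] by simp
qed

text \<open>A vanishing numerator means \<open>q ^ k = inverse p ^ k\<close>, hence
  \<open>(p * q) ^ k = 1\<close> after multiplying by \<open>p ^ k\<close>, and no positive
  \<open>k\<close> below the order allows this.\<close>

lemma pq_bracket_nonzero:
  assumes "p \<noteq> 0" "q \<noteq> 0" "p * q \<noteq> 1" and "0 < k" "k < mult_ord (p * q)"
  shows "pq_bracket p q k \<noteq> 0"
proof
  assume "pq_bracket p q k = 0"
  \<comment> \<open>Division by \<open>0\<close> yields \<open>0\<close>, so the bracket says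
    something about its numerator only once its denominator is known to be nonzero.\<close>
  moreover have "q - inverse p \<noteq> 0" using assms by auto
  ultimately have "q ^ k = inverse p ^ k" by (simp add: pq_bracket_def)
  then have "(p * q) ^ k = (p * inverse p) ^ k" by (simp only: power_mult_distrib)
  then have "(p * q) ^ k = 1" using assms by simp
  then have "mult_ord (p * q) dvd k" using assms by (simp add: power_eq_1_iff_mult_ord)
  then show False using assms by (auto dest: dvd_imp_le)
qed

lemma ideal_H_ideal: "ideal (H_ideal p q) free_ring"
  unfolding H_ideal_def
  by (rule ring.genideal_ideal[OF ring_free_ring]) (simp add: ring_of_type_algebra_def)

lemma ring_Hpq: "ring (Hpq p q)"
  unfolding Hpq_def by (rule ideal.quotient_is_ring[OF ideal_H_ideal])

text \<open>Every coset has a representative in the free algebra, so statements about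
  \<open>Hpq p q\<close> can be checked on polynomials \<open>f\<close>.\<close>

lemma carrier_Hpq: "carrier (Hpq p q) = range (H_class p q)"
  by (auto simp: Hpq_def FactRing_def A_RCOSETS_def' H_class_def ring_of_type_algebra_def)

lemma H_class_add: "H_class p q f \<oplus>\<^bsub>Hpq p q\<^esub> H_class p q g = H_class p q (f + g)"
proof -
  interpret I: ideal "H_ideal p q" free_ring by (rule ideal_H_ideal)
  have "H_class p q f \<oplus>\<^bsub>Hpq p q\<^esub> H_class p q g = H_class p q (f \<oplus>\<^bsub>free_ring\<^esub> g)"
    unfolding H_class_def Hpq_def FactRing_def
    by (simp, rule I.a_rcos_sum) (simp_all add: ring_of_type_algebra_def)
  then show ?thesis by (simp add: ring_of_type_algebra_def)
qed

lemma H_class_mult: "H_class p q f \<otimes>\<^bsub>Hpq p q\<^esub> H_class p q g = H_class p q (f * g)"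
proof -
  interpret I: ideal "H_ideal p q" free_ring by (rule ideal_H_ideal)
  have "H_class p q f \<otimes>\<^bsub>Hpq p q\<^esub> H_class p q g = H_class p q (f \<otimes>\<^bsub>free_ring\<^esub> g)"
    unfolding H_class_def Hpq_def FactRing_def
    by (simp, rule I.rcoset_mult_add) (simp_all add: ring_of_type_algebra_def)
  then show ?thesis by (simp add: ring_of_type_algebra_def)
qed

lemma one_Hpq: "\<one>\<^bsub>Hpq p q\<^esub> = H_class p q 1"
proof -
  interpret I: ideal "H_ideal p q" free_ring by (rule ideal_H_ideal)
  have "\<one>\<^bsub>Hpq p q\<^esub> = H_class p q \<one>\<^bsub>free_ring\<^esub>"
    by (simp add: H_class_def Hpq_def FactRing_def)
  then show ?thesis by (simp add: ring_of_type_algebra_def)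
qed

lemma carrier_V3: "v \<in> carrier (V3 p q l) \<longleftrightarrow> Poly_Mapping.keys v \<subseteq> {..<mult_ord (p * q)}"
  by (simp add: V3_def)

lemma zero_V3 [simp]: "\<zero>\<^bsub>V3 p q l\<^esub> = 0"
  by (simp add: V3_def)

lemma add_V3 [simp]: "v \<oplus>\<^bsub>V3 p q l\<^esub> w = v + w"
  by (simp add: V3_def)

lemma V3_add_closed:
  assumes "v \<in> carrier (V3 p q l)" "w \<in> carrier (V3 p q l)"
  shows "v + w \<in> carrier (V3 p q l)"
  using assms Poly_Mapping.keys_add[of v w] by (auto simp: carrier_V3)

lemma abelian_group_V3: "abelian_group (V3 p q l)"
proof (rule abelian_groupI)
  fix v assume "v \<in> carrier (V3 p q l)"
  then have "- v \<in> carrier (V3 p q l)" by (simp add: carrier_V3 keys_def)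
  then show "\<exists>w\<in>carrier (V3 p q l). w \<oplus>\<^bsub>V3 p q l\<^esub> v = \<zero>\<^bsub>V3 p q l\<^esub>"
    by (intro bexI[of _ "- v"]) simp_all
next
  show "\<zero>\<^bsub>V3 p q l\<^esub> \<in> carrier (V3 p q l)" by (simp add: carrier_V3)
qed (simp_all add: V3_add_closed add_ac)

text \<open>On representatives the action is \<open>V3_free\<close>, by
  \<open>V3_raction_class\<close>; the module laws are then its linearity and its compatibility with
  products and \<open>1\<close>.\<close>

lemma right_module_V3:
  assumes "p \<noteq> 0" "q \<noteq> 0" "p * q \<noteq> 1"
  shows "right_module (Hpq p q) (V3 p q l)"
proof -
  \<comment> \<open>\<open>V3_raction_class\<close> speaks only of vectors in the carrier; for
    associativity it is applied a second time, to an image vector.\<close>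
  have cl: "V3_free p q l v f \<in> carrier (V3 p q l)" if "v \<in> carrier (V3 p q l)" for v f
    using that unfolding carrier_V3 by (rule V3_free_closed)
  note act = V3_raction_class[OF assms]
  show ?thesis
    by (intro right_module.intro ring_Hpq abelian_group_V3 right_module_axioms.intro)
      (auto simp: carrier_Hpq H_class_add H_class_mult one_Hpq act cl V3_add_closed
        V3_free_linear V3_free_add V3_free_mult V3_free_one)
qed

text \<open>Submodules are defined as additive subgroups stable under the action. Closure under
  scalars follows because the class of \<open>scale c 1\<close> acts as multiplication by
  \<open>c\<close>.\<close>

lemma right_submodule_V3D:
  assumes "p \<noteq> 0" "q \<noteq> 0" "p * q \<noteq> 1" and "right_submodule N (Hpq p q) (V3 p q l)"
  shows "N \<subseteq> carrier (V3 p q l)" and "0 \<in> N"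
    and "\<And>v w. v \<in> N \<Longrightarrow> w \<in> N \<Longrightarrow> v + w \<in> N"
    and "\<And>v f. v \<in> N \<Longrightarrow> V3_free p q l v f \<in> N"
    and "\<And>v c. v \<in> N \<Longrightarrow> scale c v \<in> N"
proof -
  have sub: "subgroup N (add_monoid (V3 p q l))"
    and act: "\<And>v A. v \<in> N \<Longrightarrow> A \<in> carrier (Hpq p q) \<Longrightarrow> v \<triangleleft>\<^bsub>V3 p q l\<^esub> A \<in> N"
    using assms(4) by (auto simp: right_submodule_def)
  show N: "N \<subseteq> carrier (V3 p q l)" and "0 \<in> N"
    and "\<And>v w. v \<in> N \<Longrightarrow> w \<in> N \<Longrightarrow> v + w \<in> N"
    using subgroup.subset[OF sub] subgroup.one_closed[OF sub] subgroup.m_closed[OF sub] by auto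
  show free: "V3_free p q l v f \<in> N" if "v \<in> N" for v f
    using act[OF that, of "H_class p q f"] V3_raction_class[OF assms(1-3), of v l f] that N
    by (auto simp: carrier_Hpq)
  show "scale c v \<in> N" if "v \<in> N" for v c
    using free[OF that, of "scale c 1"] by (simp add: V3_free_scale V3_free_one)
qed

text \<open>Expands a vector in basis vectors, the form in which closure under sums and scalars
  applies.\<close>

lemma linear_extension_basis_vec: "linear_extension basis_vec v = v"
  using additive_eq_linear_extension[of "\<lambda>v. v" v] by simp

text \<open>By linearity it suffices to treat basis vectors, where \<open>x\<close> is a weighted
  downward shift. The coefficientwise form makes the leading index easy to follow.\<close>

lemma lookup_V3_free_gen_x:
  "Poly_Mapping.lookup (V3_free p q l v (gen Gen_x)) j =
     l * pq_bracket p q (Suc j) * Poly_Mapping.lookup v (Suc j)"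
  unfolding V3_free_gen
proof (induction v rule: poly_mapping_basis_induct)
  case (add c b v)
  have "Poly_Mapping.lookup (V3_gen p q l Gen_x b) j =
      l * pq_bracket p q (Suc j) * Poly_Mapping.lookup (basis_vec b :: nat \<Rightarrow>\<^sub>0 'a) (Suc j)"
    by (cases b) (auto simp: V3_gen_def)
  with add show ?case
    by (simp add: linear_extension_add linear_extension_scale lookup_add algebra_simps)
qed simp

text \<open>Induction on the leading index \<open>K\<close>: applying \<open>x\<close> gives an
  element of \<open>N\<close> with leading index one lower, since the factor
  \<open>l * pq_bracket p q K\<close> is nonzero.\<close>

lemma V3_submodule_basis_vec_0:
  assumes pq: "p \<noteq> 0" "q \<noteq> 0" "p * q \<noteq> 1" and "l \<noteq> 0"
    and N: "right_submodule N (Hpq p q) (V3 p q l)"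
    and "v \<in> N" and "Poly_Mapping.lookup v K \<noteq> 0" and "\<And>j. K < j \<Longrightarrow> Poly_Mapping.lookup v j = 0"
  shows "basis_vec 0 \<in> N"
  using assms(6-)
proof (induction K arbitrary: v)
  case 0
  \<comment> \<open>All coefficients above index \<open>0\<close> vanish, so \<open>v\<close> is a
    nonzero multiple of \<open>basis_vec 0\<close> and only needs rescaling.\<close>
  have "scale (inverse (Poly_Mapping.lookup v 0)) v = basis_vec 0"
    using 0 by (intro poly_mapping_eqI) auto
  then show ?case using right_submodule_V3D(5)[OF pq N] 0 by metis
next
  case (Suc K)
  \<comment> \<open>Membership in the carrier bounds the leading index by the order, the range where
    the bracket is nonzero.\<close>
  have "v \<in> carrier (V3 p q l)" using Suc.prems(1) right_submodule_V3D(1)[OF pq N] by blast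
  moreover have "Suc K \<in> Poly_Mapping.keys v" using Suc.prems(2) by (simp add: in_keys_iff)
  ultimately have "Suc K < mult_ord (p * q)" unfolding carrier_V3 by blast
  then have "pq_bracket p q (Suc K) \<noteq> 0" by (intro pq_bracket_nonzero pq) auto
  then have "Poly_Mapping.lookup (V3_free p q l v (gen Gen_x)) K \<noteq> 0"
    using Suc.prems(2) \<open>l \<noteq> 0\<close> by (simp add: lookup_V3_free_gen_x)
  moreover have "Poly_Mapping.lookup (V3_free p q l v (gen Gen_x)) j = 0" if "K < j" for j
    using Suc.prems(3)[of "Suc j"] that by (simp add: lookup_V3_free_gen_x)
  ultimately show ?case
    using right_submodule_V3D(4)[OF pq N Suc.prems(1)] by (intro Suc.IH)
qed

text \<open>Repeated use of \<open>y\<close> climbs from \<open>basis_vec 0\<close> through all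
  basis vectors, and these span the carrier.\<close>

lemma V3_submodule_eq_carrier:
  assumes pq: "p \<noteq> 0" "q \<noteq> 0" "p * q \<noteq> 1"
    and N: "right_submodule N (Hpq p q) (V3 p q l)" and 0: "basis_vec 0 \<in> N"
  shows "N = carrier (V3 p q l)"
proof
  note sub = right_submodule_V3D[OF pq N]
  show "N \<subseteq> carrier (V3 p q l)" by (rule sub(1))
  have basis: "basis_vec k \<in> N" if "k < mult_ord (p * q)" for k
    using that
  proof (induction k)
    case (Suc k)
    \<comment> \<open>As \<open>Suc k\<close> is still below the order, \<open>y\<close> has not yet
      reached the index that it sends to \<open>0\<close>.\<close>
    then show ?case
      using sub(4)[of "basis_vec k" "gen Gen_y"] by (simp add: V3_free_gen V3_gen_def)
  qed (rule 0)
  have sum: "(\<And>b. b \<in> S \<Longrightarrow> h b \<in> N) \<Longrightarrow> sum h S \<in> N" for h :: "nat \<Rightarrow> _" and S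
    by (induction S rule: infinite_finite_induct) (auto intro: sub(2,3))
  show "carrier (V3 p q l) \<subseteq> N"
  proof
    fix v assume "v \<in> carrier (V3 p q l)"
    then have "linear_extension basis_vec v \<in> N"
      unfolding linear_extension_def by (intro sum sub(5) basis) (auto simp: carrier_V3)
    then show "v \<in> N" by (simp add: linear_extension_basis_vec)
  qed
qed

lemma simple_V3:
  assumes pq: "p \<noteq> 0" "q \<noteq> 0" "p * q \<noteq> 1" and "l \<noteq> 0" and "0 < mult_ord (p * q)"
  shows "simple_right_module (Hpq p q) (V3 p q l)"
  unfolding simple_right_module_def
proof (intro conjI allI impI)
  show "right_module (Hpq p q) (V3 p q l)" by (rule right_module_V3[OF pq])
  \<comment> \<open>Positivity of the order puts the index \<open>0\<close> in the allowed range; an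
    order of \<open>0\<close> would leave only the zero vector.\<close>
  have "basis_vec 0 \<in> carrier (V3 p q l)" "basis_vec 0 \<noteq> (0 :: nat \<Rightarrow>\<^sub>0 'a)"
    using assms(5) by (auto simp: carrier_V3 basis_vec_def)
  then show "carrier (V3 p q l) \<noteq> {\<zero>\<^bsub>V3 p q l\<^esub>}" by auto
  fix N assume N: "right_submodule N (Hpq p q) (V3 p q l)"
  show "N = {\<zero>\<^bsub>V3 p q l\<^esub>} \<or> N = carrier (V3 p q l)"
  proof (rule disjCI)
    assume "N \<noteq> carrier (V3 p q l)"
    then have no: "basis_vec 0 \<notin> N" using V3_submodule_eq_carrier[OF pq N] by blast
    have "v = 0" if "v \<in> N" for v
    proof (rule ccontr)
      assume "v \<noteq> 0"
      \<comment> \<open>The support is finite and nonempty, so its maximum serves as the leading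
        index.\<close>
      then have "Max (Poly_Mapping.keys v) \<in> Poly_Mapping.keys v" by (intro Max_in) auto
      moreover have "Poly_Mapping.lookup v j = 0" if "Max (Poly_Mapping.keys v) < j" for j
        using that Max_ge[OF finite_keys[of v], of j] by (meson in_keys_iff not_le)
      ultimately show False
        using V3_submodule_basis_vec_0[OF pq \<open>l \<noteq> 0\<close> N \<open>v \<in> N\<close>] no by (auto simp: in_keys_iff)
    qed
    then show "N = {\<zero>\<^bsub>V3 p q l\<^esub>}" using right_submodule_V3D(2)[OF pq N] by auto
  qed
qed

text \<open>The vectors \<open>basis_vec k\<close> with \<open>k\<close> below the order form a
  basis: expansion gives spanning, comparison of coefficients gives independence.\<close>

lemma dim_V3: "vector_space.dim scale (carrier (V3 p q l)) = mult_ord (p * q)"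
proof -
  interpret V: vector_space "scale :: 'a \<Rightarrow> (nat \<Rightarrow>\<^sub>0 'a) \<Rightarrow> _" by (rule vector_space_scale)
  let ?B = "(basis_vec :: nat \<Rightarrow> nat \<Rightarrow>\<^sub>0 'a) ` {..<mult_ord (p * q)}"
  have inj: "inj (basis_vec :: nat \<Rightarrow> nat \<Rightarrow>\<^sub>0 'a)"
    by (rule injI) (metis basis_vec_def keys_single singleton_inject zero_neq_one)
  show ?thesis
  proof (rule V.dim_unique)
    show "?B \<subseteq> carrier (V3 p q l)" by (auto simp: carrier_V3 basis_vec_def)
    show "carrier (V3 p q l) \<subseteq> V.span ?B"
    proof
      fix v assume "v \<in> carrier (V3 p q l)"
      then have "linear_extension basis_vec v \<in> V.span ?B"
        unfolding linear_extension_def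
        by (intro V.span_sum V.span_scale V.span_base) (auto simp: carrier_V3)
      then show "v \<in> V.span ?B" by (simp add: linear_extension_basis_vec)
    qed
    show "V.independent ?B"
    proof (rule V.independent_if_scalars_zero)
      fix u :: "(nat \<Rightarrow>\<^sub>0 'a) \<Rightarrow> 'a" and b
      assume z: "(\<Sum>b\<in>?B. scale (u b) b) = 0" and "b \<in> ?B"
      then obtain k where k: "b = basis_vec k" "k < mult_ord (p * q)" by auto
      \<comment> \<open>Reading off the coefficient at \<open>k\<close> isolates the scalar of
        \<open>b\<close>. Injectivity of \<open>basis_vec\<close> identifies this indexed sum with
        the sum over \<open>?B\<close>.\<close>
      have "Poly_Mapping.lookup (\<Sum>i<mult_ord (p * q). scale (u (basis_vec i)) (basis_vec i)) k = u b"
        using k by (simp add: lookup_sum mult_delta_right)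
      then show "u b = 0"
        using z by (simp add: sum.reindex[OF inj_on_subset[OF inj subset_UNIV]])
    qed simp
    show "card ?B = mult_ord (p * q)" by (simp add: card_image[OF inj_on_subset[OF inj subset_UNIV]])
  qed
qed

theorem theorem5p3:
  fixes p q lam :: "'k::alg_closed_field" and m n :: nat
  assumes "p \<noteq> 0" and "q \<noteq> 0" and "p * q \<noteq> 1"
    and "primitive_root_of_unity m p" and "primitive_root_of_unity n q"
    and "lam \<noteq> 0"
  shows "simple_right_module (Hpq p q) (V3 p q lam) \<and>
         vector_space.dim scale (carrier (V3 p q lam)) = mult_ord (p * q)"
proof
  \<comment> \<open>The positive exponent \<open>m * n\<close> is a common multiple of the orders of
    \<open>p\<close> and \<open>q\<close>, so it sends \<open>p * q\<close> to \<open>1\<close> and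
    shows that its order is finite.\<close>
  have "(p * q) ^ (m * n) = (p ^ m) ^ n * (q ^ n) ^ m"
    by (simp add: power_mult_distrib mult.commute[of m n] flip: power_mult)
  then have "0 < mult_ord (p * q)"
    using assms by (intro mult_ord_pos[of _ "m * n"]) (simp_all add: primitive_root_of_unity_def)
  then show "simple_right_module (Hpq p q) (V3 p q lam)"
    using assms by (intro simple_V3)
qed (rule dim_V3)

end
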